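(* Let $G$ be a locally compact (Hausdorff) abelian group and let $x,y\in G$. If $g\in L^1(G)$ is an even function (i.e. $g(-u)=g(u)$), then $$L_yg \star_c L_xg = g\star_c \frac{L_{x+y}g + L_{x-y}g}{2}.$$
   Context: $G$ is written additively, with Haar measure used in all integrals; $L^1(G)$ is the space of complex-valued integrable functions on $G$ (modulo a.e. equality). The cosine convolution of $f,g\in L^1(G)$ is $$f\star_c g(x) := \int_G f(y)\cdot\frac{g(x+y)+g(x-y)}{2}\,dy,$$ which is finite for almost every $x\in G$ and defines an element of $L^1(G)$ with $\|f\star_c g\|_1\leqslant\|f\|_1\|g\|_1$. For $z\in G$ the operator $L_z:L^1(G)\to L^1(G)$ is given by $L_zf(u):=f(u-z)$ for $u\in G$. *)

theory Defs
  imports "HOL-Analysis.Analysis"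
begin

text \<open>
  A Haar measure is a nonzero translation-invariant Radon measure on the Borel sets: finite on
  compact sets, outer regular on Borel sets and inner regular on open sets. No \<open>\<sigma>\<close>-finiteness
  or second countability is imposed.
\<close>

definition haar_measure :: "'a::{topological_ab_group_add, t2_space} measure \<Rightarrow> bool" where
  "haar_measure \<mu> \<longleftrightarrow>
     sets \<mu> = sets borel \<and>
     emeasure \<mu> UNIV \<noteq> 0 \<and>
     (\<forall>K. compact K \<longrightarrow> emeasure \<mu> K < \<infinity>) \<and>
     (\<forall>A\<in>sets borel. emeasure \<mu> A = (INF U\<in>{U. open U \<and> A \<subseteq> U}. emeasure \<mu> U)) \<and>
     (\<forall>U. open U \<longrightarrow> emeasure \<mu> U = (SUP K\<in>{K. compact K \<and> K \<subseteq> U}. emeasure \<mu> K)) \<and>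
     (\<forall>z. \<forall>A\<in>sets borel. emeasure \<mu> ((\<lambda>u. z + u) ` A) = emeasure \<mu> A)"

text \<open>
  Elements of \<open>L\<^sup>1(G)\<close> are represented by integrable functions, and equality in \<open>L\<^sup>1(G)\<close> is equality
  almost everywhere. In \<open>cosine_conv\<close> the Bochner integral takes the value \<open>0\<close> where the integrand is
  not integrable; for integrable \<open>f\<close> and \<open>g\<close> this happens only on a null set, so the class
  of the convolution in \<open>L\<^sup>1(G)\<close> does not depend on that convention.
\<close>

definition cosine_conv ::
  "'a::{topological_ab_group_add, t2_space} measure \<Rightarrow> ('a \<Rightarrow> complex) \<Rightarrow> ('a \<Rightarrow> complex) \<Rightarrow> 'a \<Rightarrow> complex"
  where "cosine_conv \<mu> f g x = (\<integral>y. f y * ((g (x + y) + g (x - y)) / 2) \<partial>\<mu>)"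

definition translate :: "'a::ab_group_add \<Rightarrow> ('a \<Rightarrow> complex) \<Rightarrow> 'a \<Rightarrow> complex" where
  "translate z f u = f (u - z)"

end

theory Submission
  imports Defs
begin

text \<open>
  For \<open>w\<close> in \<open>G\<close> put \<open>A(w) = \<integral> g(t) g(w + t) dt\<close> and \<open>B(w) = \<integral> g(t) g(w - t) dt\<close>. Translating
  the variable by \<open>- w\<close> turns \<open>A(w)\<close> into \<open>\<integral> g(t - w) g(t) dt\<close>, and evenness of \<open>g\<close> makes this \<open>B(w)\<close>
  (\<open>even_correlation_eq_convolution\<close>). With \<open>P = u - x + y\<close> and \<open>Q = u - x - y\<close>, the substitution
  \<open>t \<mapsto> y + t\<close> shows that the left-hand side at \<open>u\<close> is \<open>(A(P) + B(Q)) / 2\<close>, while the right-hand side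
  at \<open>u\<close> is \<open>(A(P) + A(Q) + B(P) + B(Q)) / 4\<close>. Both equal \<open>(A(P) + A(Q)) / 2\<close>.

  Splitting the integrals in this way requires the products \<open>g(t) g(w + t)\<close> to be integrable in \<open>t\<close>
  for almost every \<open>w\<close> (\<open>AE_integrable_correlation\<close>), and most of the work goes into that. For a
  \<open>\<sigma>\<close>-finite measure and a second countable group it is Tonelli's theorem, but here \<open>\<mu>\<close> may fail to
  be \<open>\<sigma>\<close>-finite and \<open>(w, t) \<mapsto> g(w + t)\<close> may fail to be measurable for the product \<open>\<sigma>\<close>-algebra. The
  regularity of \<open>\<mu>\<close> replaces it. Outer regularity gives an integrable majorant
  \<open>\<phi> = \<Sum>\<^sub>k c\<^sub>k 1\<^bsub>U\<^sub>k\<^esub>\<close> of \<open>|g|\<close> with open sets \<open>U\<^sub>k\<close> (\<open>open_step_sum_majorant\<close>). The function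
  \<open>\<Phi>(w) = \<integral> \<phi>(t) \<phi>(w + t) dt\<close> is then lower semicontinuous in a strong sense: near a point where
  \<open>\<Phi> > l\<close>, one function \<open>h(t)\<close>, the same for all nearby \<open>w\<close>, lies below \<open>\<phi>(t) \<phi>(w + t)\<close> and has integral
  above \<open>l\<close> (\<open>correlation_locally_bounded_below\<close>). On a compact subset of \<open>{\<Phi> > l}\<close> finitely many such
  functions suffice, so that exchanging the two integrations only exchanges a finite sum with an
  integral. The result is the weak type estimate \<open>l \<mu>{\<Phi> > l} \<le> (\<integral> \<phi>)\<^sup>2\<close> (\<open>correlation_weak_type\<close>), and
  letting \<open>l\<close> tend to infinity shows that \<open>\<Phi>\<close> is finite almost everywhere.
\<close>

section \<open>Translation invariance of Haar integrals\<close>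

lemma sets_haar_measure: "haar_measure \<mu> \<Longrightarrow> sets \<mu> = sets borel"
  by (simp add: haar_measure_def)

lemma space_haar_measure: "haar_measure \<mu> \<Longrightarrow> space \<mu> = UNIV"
  using sets_eq_imp_space_eq[OF sets_haar_measure] by simp

lemma measurable_haar_measure_iff:
  "haar_measure \<mu> \<Longrightarrow> f \<in> measurable \<mu> N \<longleftrightarrow> f \<in> measurable borel N"
  by (simp cong: measurable_cong_sets add: sets_haar_measure)

lemma borel_measurable_haar_compose_continuous:
  fixes \<mu> :: "'a::{topological_ab_group_add, t2_space} measure"
  assumes "haar_measure \<mu>" and "h \<in> borel_measurable \<mu>" and "continuous_on UNIV k"
  shows "(\<lambda>t. h (k t)) \<in> borel_measurable \<mu>"
  using measurable_compose[OF borel_measurable_continuous_onI[OF assms(3)], of h borel] assms(1,2)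
  by (simp add: measurable_haar_measure_iff)

lemma measurable_haar_translate:
  fixes \<mu> :: "'a::{topological_ab_group_add, t2_space} measure"
  assumes "haar_measure \<mu>"
  shows "(\<lambda>u. z + u) \<in> measurable \<mu> \<mu>"
proof -
  have "(\<lambda>u. z + u) \<in> borel_measurable borel"
    by (intro borel_measurable_continuous_onI continuous_intros)
  then show ?thesis
    by (simp cong: measurable_cong_sets add: sets_haar_measure[OF assms])
qed

lemma distr_haar_translate:
  fixes \<mu> :: "'a::{topological_ab_group_add, t2_space} measure"
  assumes "haar_measure \<mu>"
  shows "distr \<mu> \<mu> (\<lambda>u. z + u) = \<mu>"
proof (rule measure_eqI)
  fix A assume A: "A \<in> sets (distr \<mu> \<mu> (\<lambda>u. z + u))"
  have m: "(\<lambda>u. z + u) \<in> measurable \<mu> \<mu>"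
    by (rule measurable_haar_translate[OF assms])
  have inv: "emeasure \<mu> ((\<lambda>u. w + u) ` B) = emeasure \<mu> B" if "B \<in> sets borel" for w B
    using assms that unfolding haar_measure_def by blast
  have "(\<lambda>u. z + u) -` A = (\<lambda>u. - z + u) ` A"
  proof (intro set_eqI iffI)
    fix x assume "x \<in> (\<lambda>u. z + u) -` A"
    then show "x \<in> (\<lambda>u. - z + u) ` A"
      by (intro image_eqI[of _ _ "z + x"]) auto
  qed auto
  then show "emeasure (distr \<mu> \<mu> (\<lambda>u. z + u)) A = emeasure \<mu> A"
    using A m inv[of A "- z"] by (simp add: emeasure_distr space_haar_measure[OF assms] sets_haar_measure[OF assms])
qed simp

lemma nn_integral_haar_translate:
  fixes \<mu> :: "'a::{topological_ab_group_add, t2_space} measure"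
  assumes "haar_measure \<mu>" and "f \<in> borel_measurable \<mu>"
  shows "(\<integral>\<^sup>+u. f (z + u) \<partial>\<mu>) = (\<integral>\<^sup>+u. f u \<partial>\<mu>)"
  using nn_integral_distr[OF measurable_haar_translate[OF assms(1)], of f z] assms
  by (simp add: distr_haar_translate)

lemma integral_haar_translate:
  fixes \<mu> :: "'a::{topological_ab_group_add, t2_space} measure" and f :: "'a \<Rightarrow> complex"
  assumes "haar_measure \<mu>" and "f \<in> borel_measurable \<mu>"
  shows "(\<integral>u. f (z + u) \<partial>\<mu>) = (\<integral>u. f u \<partial>\<mu>)"
  using integral_distr[OF measurable_haar_translate[OF assms(1)], of f z] assms
  by (simp add: distr_haar_translate)

lemma integrable_haar_translate:
  fixes \<mu> :: "'a::{topological_ab_group_add, t2_space} measure" and f :: "'a \<Rightarrow> complex"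
  assumes "haar_measure \<mu>" and "f \<in> borel_measurable \<mu>"
  shows "integrable \<mu> (\<lambda>u. f (z + u)) \<longleftrightarrow> integrable \<mu> f"
  using integrable_distr_eq[OF measurable_haar_translate[OF assms(1)], of f z] assms
  by (simp add: distr_haar_translate)

lemma AE_haar_translate:
  fixes \<mu> :: "'a::{topological_ab_group_add, t2_space} measure"
  assumes "haar_measure \<mu>" and "AE u in \<mu>. P u"
  shows "AE u in \<mu>. P (z + u)"
  by (rule AE_distrD[OF measurable_haar_translate[OF assms(1)]])
    (subst distr_haar_translate[OF assms(1)], rule assms(2))

section \<open>Majorants by open sets\<close>

definition open_step_sum :: "(nat \<Rightarrow> ennreal) \<Rightarrow> (nat \<Rightarrow> 'a set) \<Rightarrow> 'a \<Rightarrow> ennreal" where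
  "open_step_sum c U t = (\<Sum>k. c k * indicator (U k) t)"

lemma borel_measurable_open_step_sum:
  fixes U :: "nat \<Rightarrow> 'a::topological_space set"
  assumes "\<And>k. open (U k)"
  shows "open_step_sum c U \<in> borel_measurable borel"
proof -
  have [measurable]: "U k \<in> sets borel" for k
    using assms by simp
  show ?thesis
    unfolding open_step_sum_def by measurable
qed

lemma nn_integral_indicator_sum:
  assumes [measurable]: "\<And>k. U k \<in> sets \<mu>"
  shows "(\<integral>\<^sup>+t. (\<Sum>k::nat. c k * indicator (U k) t) \<partial>\<mu>) = (\<Sum>k. c k * emeasure \<mu> (U k))"
  by (subst nn_integral_suminf) (simp_all add: nn_integral_cmult_indicator)

text \<open>
  The layers are the sets \<open>2\<^sup>m \<le> f < 2\<^sup>m\<^sup>+\<^sup>1\<close> for integers \<open>m\<close>, enumerated by the natural numbers, with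
  \<open>2\<^sup>m\<^sup>+\<^sup>1\<close> as coefficient. They are disjoint, so the sum has at most one nonzero term, and rounding \<open>f\<close>
  up to the next power of two costs at most the factor two.
\<close>

lemma dyadic_layers:
  fixes f :: "'a \<Rightarrow> real"
  assumes "f \<in> borel_measurable M" and f_nonneg: "\<And>t. 0 \<le> f t"
  obtains A :: "nat \<Rightarrow> 'a set" and d :: "nat \<Rightarrow> real"
  where "\<And>k. A k \<in> sets M" and "\<And>k. 0 < d k"
    and "\<And>t. t \<in> space M \<Longrightarrow> ennreal (f t) \<le> (\<Sum>k. ennreal (d k) * indicator (A k) t)"
    and "\<And>t. (\<Sum>k. ennreal (d k) * indicator (A k) t) \<le> 2 * ennreal (f t)"
proof
  note [measurable] = assms(1)
  define A where "A k = {t \<in> space M. 0 < f t \<and> \<lfloor>log 2 (f t)\<rfloor> = int_decode k}" for k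
  define d where "d k = 2 powr (real_of_int (int_decode k) + 1)" for k
  show "A k \<in> sets M" for k
    unfolding A_def by measurable
  show "0 < d k" for k
    by (simp add: d_def)
  have disj: "disjoint_family A"
    unfolding disjoint_family_on_def A_def
    by (auto dest: injD[OF inj_int_decode])
  have eq: "(\<Sum>k. ennreal (d k) * indicator (A k) t) = ennreal (d k)" if "t \<in> A k" for t k
    using suminf_cmult_indicator[OF disj that, of "\<lambda>k. ennreal (d k)"] .
  have bounds: "f t \<le> d k" "d k \<le> 2 * f t" if "t \<in> A k" for t k
  proof -
    have pos: "0 < f t" and fl: "\<lfloor>log 2 (f t)\<rfloor> = int_decode k"
      using that by (auto simp: A_def)
    have ft: "2 powr log 2 (f t) = f t"
      using pos by simp
    have "2 powr log 2 (f t) \<le> d k"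
      unfolding d_def by (rule powr_mono) (use fl in linarith, simp)
    then show "f t \<le> d k"
      by (simp add: ft)
    have "2 powr real_of_int (int_decode k) \<le> 2 powr log 2 (f t)"
      by (rule powr_mono) (use fl in linarith, simp)
    then show "d k \<le> 2 * f t"
      by (simp add: ft d_def powr_add)
  qed
  have cover: "\<exists>k. t \<in> A k" if "t \<in> space M" "0 < f t" for t
    using that int_decode_inverse int_encode_inverse
    by (intro exI[of _ "int_encode \<lfloor>log 2 (f t)\<rfloor>"]) (simp add: A_def)
  show "ennreal (f t) \<le> (\<Sum>k. ennreal (d k) * indicator (A k) t)" if t: "t \<in> space M" for t
  proof (cases "0 < f t")
    case True
    then obtain k where "t \<in> A k"
      using cover t by blast
    then show ?thesis
      by (simp add: eq bounds ennreal_leI)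
  next
    case False
    then have "f t = 0"
      using f_nonneg[of t] by simp
    then show ?thesis
      by simp
  qed
  show "(\<Sum>k. ennreal (d k) * indicator (A k) t) \<le> 2 * ennreal (f t)" for t
  proof (cases "\<exists>k. t \<in> A k")
    case True
    then obtain k where "t \<in> A k" ..
    then have "ennreal (d k) \<le> ennreal (2 * f t)"
      by (simp add: bounds ennreal_leI)
    then show ?thesis
      using \<open>t \<in> A k\<close> f_nonneg[of t] by (simp add: eq ennreal_mult)
  next
    case False
    then show ?thesis
      by simp
  qed
qed

text \<open>
  Each dyadic layer of \<open>|g|\<close> has finite measure, so outer regularity encloses the \<open>k\<close>-th layer in an
  open set at an additional cost of at most \<open>2\<^sup>-\<^sup>(\<^sup>k\<^sup>+\<^sup>1\<^sup>)\<close> after weighting by its coefficient. The total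
  excess is at most one.
\<close>

lemma open_step_sum_majorant:
  fixes \<mu> :: "'a::{topological_ab_group_add, t2_space} measure" and g :: "'a \<Rightarrow> complex"
  assumes haar: "haar_measure \<mu>" and g: "integrable \<mu> g"
  obtains c U where "\<And>k. open (U k)" and "\<And>k. c k < top"
    and "\<And>t. ennreal (norm (g t)) \<le> open_step_sum c U t"
    and "(\<integral>\<^sup>+t. open_step_sum c U t \<partial>\<mu>) < top"
proof -
  have "(\<lambda>t. norm (g t)) \<in> borel_measurable \<mu>"
    using g by auto
  then obtain A d where A[measurable]: "\<And>k. A k \<in> sets \<mu>" and d: "\<And>k. 0 < (d k :: real)"
    and lower: "\<And>t. t \<in> space \<mu> \<Longrightarrow> ennreal (norm (g t)) \<le> (\<Sum>k. ennreal (d k) * indicator (A k) t)"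
    and upper: "\<And>t. (\<Sum>k. ennreal (d k) * indicator (A k) t) \<le> 2 * ennreal (norm (g t))"
    by (rule dyadic_layers) auto
  have fin: "(\<Sum>k. ennreal (d k) * emeasure \<mu> (A k)) < top"
  proof -
    have "(\<Sum>k. ennreal (d k) * emeasure \<mu> (A k)) = (\<integral>\<^sup>+t. (\<Sum>k. ennreal (d k) * indicator (A k) t) \<partial>\<mu>)"
      by (simp add: nn_integral_indicator_sum)
    also have "\<dots> \<le> (\<integral>\<^sup>+t. 2 * ennreal (norm (g t)) \<partial>\<mu>)"
      by (intro nn_integral_mono upper)
    also have "\<dots> = 2 * (\<integral>\<^sup>+t. ennreal (norm (g t)) \<partial>\<mu>)"
      using g by (intro nn_integral_cmult) auto
    also have "\<dots> < top"
      using g by (auto simp: integrable_iff_bounded ennreal_mult_less_top)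
    finally show ?thesis .
  qed
  have "\<exists>U. open U \<and> A k \<subseteq> U \<and> emeasure \<mu> U \<le> emeasure \<mu> (A k) + ennreal ((1/2) ^ Suc k / d k)" for k
  proof -
    have "ennreal (d k) * emeasure \<mu> (A k) \<le> (\<Sum>k. ennreal (d k) * emeasure \<mu> (A k))"
      using sum_le_suminf[of "\<lambda>k. ennreal (d k) * emeasure \<mu> (A k)" "{k}"] by simp
    then have "ennreal (d k) * emeasure \<mu> (A k) < top"
      using fin by (rule le_less_trans)
    then have "emeasure \<mu> (A k) < top"
      using d[of k] by (auto simp: ennreal_mult_less_top)
    then have "emeasure \<mu> (A k) < emeasure \<mu> (A k) + ennreal ((1/2) ^ Suc k / d k)"
      using d[of k] by (cases "emeasure \<mu> (A k)") (auto simp flip: ennreal_plus intro!: ennreal_lessI simp: add_pos_nonneg add_nonneg_pos)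
    moreover have "emeasure \<mu> (A k) = (INF U\<in>{U. open U \<and> A k \<subseteq> U}. emeasure \<mu> U)"
      using haar A[of k] unfolding haar_measure_def by metis
    ultimately have "(INF U\<in>{U. open U \<and> A k \<subseteq> U}. emeasure \<mu> U) < emeasure \<mu> (A k) + ennreal ((1/2) ^ Suc k / d k)"
      by simp
    then show ?thesis
      unfolding INF_less_iff by (auto intro: less_imp_le)
  qed
  then obtain U where U: "\<And>k. open (U k)" "\<And>k. A k \<subseteq> U k"
      "\<And>k. emeasure \<mu> (U k) \<le> emeasure \<mu> (A k) + ennreal ((1/2) ^ Suc k / d k)"
    by metis
  have sets_U: "U k \<in> sets \<mu>" for k
    using U(1) haar by (simp add: sets_haar_measure)
  show ?thesis
  proof (rule that[of U "\<lambda>k. ennreal (d k)"])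
    show "open (U k)" for k by (rule U)
    show "ennreal (d k) < top" for k by simp
    show "ennreal (norm (g t)) \<le> open_step_sum (\<lambda>k. ennreal (d k)) U t" for t
    proof -
      have "(\<Sum>k. ennreal (d k) * indicator (A k) t) \<le> (\<Sum>k. ennreal (d k) * indicator (U k) t)"
        using U(2) by (intro suminf_le mult_left_mono) (auto simp: indicator_def)
      with lower[of t] show ?thesis
        by (simp add: open_step_sum_def space_haar_measure[OF haar])
    qed
    have "(\<integral>\<^sup>+t. open_step_sum (\<lambda>k. ennreal (d k)) U t \<partial>\<mu>) = (\<Sum>k. ennreal (d k) * emeasure \<mu> (U k))"
      unfolding open_step_sum_def by (rule nn_integral_indicator_sum[OF sets_U])
    also have "\<dots> \<le> (\<Sum>k. ennreal (d k) * emeasure \<mu> (A k) + ennreal ((1/2) ^ Suc k))"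
    proof (intro suminf_le)
      fix k
      have "ennreal (d k) * emeasure \<mu> (U k)
          \<le> ennreal (d k) * (emeasure \<mu> (A k) + ennreal ((1/2) ^ Suc k / d k))"
        by (intro mult_left_mono U(3)) simp
      also have "\<dots> = ennreal (d k) * emeasure \<mu> (A k) + ennreal ((1/2) ^ Suc k)"
        using d[of k] by (simp add: distrib_left flip: ennreal_mult)
      finally show "ennreal (d k) * emeasure \<mu> (U k)
          \<le> ennreal (d k) * emeasure \<mu> (A k) + ennreal ((1/2) ^ Suc k)" .
    qed auto
    also have "\<dots> = (\<Sum>k. ennreal (d k) * emeasure \<mu> (A k)) + (\<Sum>k. ennreal ((1/2) ^ Suc k))"
      by (subst suminf_add) auto
    also have "(\<Sum>k. ennreal ((1/2) ^ Suc k)) = ennreal 1"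
      by (rule suminf_ennreal_eq[OF _ power_half_series]) simp
    finally show "(\<integral>\<^sup>+t. open_step_sum (\<lambda>k. ennreal (d k)) U t \<partial>\<mu>) < top"
      by (rule le_less_trans) (use fin in simp)
  qed
qed

section \<open>Almost everywhere finiteness of the correlation\<close>

text \<open>
  Inner regularity in sequential form, so that it can be applied to finitely many open sets at once
  by adding limits.
\<close>

lemma open_measure_compact_limit:
  fixes \<mu> :: "'a::{topological_ab_group_add, t2_space} measure"
  assumes "haar_measure \<mu>" and "open V"
  obtains C where "\<And>j::nat. compact (C j)" and "\<And>j. C j \<subseteq> V"
    and "(\<lambda>j. emeasure \<mu> (C j)) \<longlonglongrightarrow> emeasure \<mu> V"
proof -
  let ?K = "{K. compact K \<and> K \<subseteq> V}"
  have sup: "emeasure \<mu> V = Sup (emeasure \<mu> ` ?K)"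
    using assms unfolding haar_measure_def by blast
  have "{} \<in> ?K"
    by simp
  then have ne: "emeasure \<mu> ` ?K \<noteq> {}"
    by (metis image_is_empty empty_iff)
  then obtain f where f: "incseq f" "range f \<subseteq> emeasure \<mu> ` ?K" "Sup (emeasure \<mu> ` ?K) = (SUP i. f i)"
    using ennreal_Sup_countable_SUP[OF ne] by auto
  then have "\<forall>j. \<exists>K. compact K \<and> K \<subseteq> V \<and> f j = emeasure \<mu> K"
    by blast
  then obtain C where C: "\<And>j. compact (C j)" "\<And>j. C j \<subseteq> V" "\<And>j. f j = emeasure \<mu> (C j)"
    by metis
  have "f \<longlonglongrightarrow> emeasure \<mu> V"
    using LIMSEQ_SUP[OF f(1)] f(3) sup by simp
  moreover have "f = (\<lambda>j. emeasure \<mu> (C j))"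
    using C(3) by auto
  ultimately show ?thesis
    using C that by blast
qed

lemma compact_translate_tube:
  fixes V :: "'a::{topological_ab_group_add, t2_space} set"
  assumes "compact C" and "open V" and "\<And>t. t \<in> C \<Longrightarrow> w\<^sub>0 + t \<in> V"
  obtains N where "open N" and "w\<^sub>0 \<in> N" and "\<And>w t. w \<in> N \<Longrightarrow> t \<in> C \<Longrightarrow> w + t \<in> V"
proof -
  have open_sum: "open ((\<lambda>p::'a \<times> 'a. fst p + snd p) -` V)"
    by (rule open_vimage[OF assms(2)]) (intro continuous_intros)
  have slice: "{w\<^sub>0} \<times> C \<subseteq> (\<lambda>p. fst p + snd p) -` V"
  proof
    fix q assume "q \<in> {w\<^sub>0} \<times> C"
    then have "fst q = w\<^sub>0" "snd q \<in> C"
      by auto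
    then show "q \<in> (\<lambda>p. fst p + snd p) -` V"
      by (simp only: vimage_eq assms(3))
  qed
  obtain N where N: "w\<^sub>0 \<in> N" "open N" "N \<times> C \<subseteq> (\<lambda>p. fst p + snd p) -` V"
    using Elementary_Topology.tube_lemma[OF assms(1) open_sum slice] by (elim exE conjE)
  have "w + t \<in> V" if prems: "w \<in> N" "t \<in> C" for w t
    using subsetD[OF N(3), of "(w, t)"] prems by simp
  with N(1,2) show ?thesis
    by (intro that[of N]) simp_all
qed

text \<open>
  By monotone convergence a finite partial sum of \<open>\<phi>(t) \<phi>(w\<^sub>0 + t)\<close> already has integral above \<open>l\<close>.
  It is a combination of indicators of the open sets \<open>U\<^sub>k \<inter> (U\<^sub>m - w\<^sub>0)\<close>, and replacing these by
  large compact subsets \<open>C\<close> keeps the integral above \<open>l\<close>. The gain is stability under perturbation: if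
  \<open>w\<^sub>0 + C \<subseteq> U\<^sub>m\<close>, then \<open>w + C \<subseteq> U\<^sub>m\<close> for all \<open>w\<close> near \<open>w\<^sub>0\<close>.
\<close>

lemma correlation_locally_bounded_below:
  fixes \<mu> :: "'a::{topological_ab_group_add, t2_space} measure"
  assumes haar: "haar_measure \<mu>"
    and U: "\<And>k. open (U k)" and c: "\<And>k. c k < top"
    and less: "l < (\<integral>\<^sup>+t. open_step_sum c U t * open_step_sum c U (w\<^sub>0 + t) \<partial>\<mu>)"
  obtains N h where "open N" and "w\<^sub>0 \<in> N" and "h \<in> borel_measurable \<mu>"
    and "l < (\<integral>\<^sup>+t. h t \<partial>\<mu>)"
    and "\<And>w t. w \<in> N \<Longrightarrow> h t \<le> open_step_sum c U t * open_step_sum c U (w + t)"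
proof -
  let ?\<phi> = "open_step_sum c U"
  \<comment> \<open>\<open>S n\<close> is a partial sum of \<open>\<phi>\<close>; a pair \<open>p = (k, m)\<close> indexes a term of the product of two of them.\<close>
  define S where "S n t = (\<Sum>k<n. c k * indicator (U k) t)" for n t
  define V where "V p = U (fst p) \<inter> {t. w\<^sub>0 + t \<in> U (snd p)}" for p :: "nat \<times> nat"
  define I where "I n = {..<n} \<times> {..<n}" for n :: nat
  define e where "e p = c (fst p) * c (snd p)" for p :: "nat \<times> nat"
  have open_V: "open (V p)" for p
  proof -
    have "open ((\<lambda>t. w\<^sub>0 + t) -` U (snd p))"
      by (rule open_vimage[OF U]) (intro continuous_intros)
    then show ?thesis
      using U unfolding V_def vimage_def by (intro open_Int) auto
  qed
  have [measurable]: "V p \<in> sets \<mu>" for p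
    using open_V haar by (simp add: sets_haar_measure)
  have S_le: "S n t \<le> ?\<phi> t" for n t
    unfolding S_def open_step_sum_def by (intro sum_le_suminf) auto
  have S_sup: "?\<phi> t = (SUP n. S n t)" for t
    unfolding S_def open_step_sum_def by (rule suminf_eq_SUP)
  have S_inc: "incseq (\<lambda>n. S n t)" for t
    unfolding S_def by (intro incseq_SucI) simp
  have S_prod: "S n t * S n w = (\<Sum>p\<in>I n. e p * (indicator (U (fst p)) t * indicator (U (snd p)) w))" for n t w
    unfolding S_def I_def e_def
    by (simp only: sum_product sum.cartesian_product case_prod_unfold ac_simps)
  have S_prod_V: "S n t * S n (w\<^sub>0 + t) = (\<Sum>p\<in>I n. e p * indicator (V p) t)" for n t
    unfolding S_prod by (intro sum.cong) (auto simp: V_def indicator_def)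
  have "(\<integral>\<^sup>+t. ?\<phi> t * ?\<phi> (w\<^sub>0 + t) \<partial>\<mu>) = (\<integral>\<^sup>+t. (SUP n. S n t * S n (w\<^sub>0 + t)) \<partial>\<mu>)"
  proof (intro nn_integral_cong)
    fix t
    have "(SUP n. S n t * S n (w\<^sub>0 + t)) = (SUP n. S n t) * (SUP n. S n (w\<^sub>0 + t))"
    proof (rule antisym)
      show "(SUP n. S n t * S n (w\<^sub>0 + t)) \<le> (SUP n. S n t) * (SUP n. S n (w\<^sub>0 + t))"
        by (intro SUP_least mult_mono SUP_upper) auto
      have "(SUP n. S n t) * (SUP n. S n (w\<^sub>0 + t)) = (SUP m. SUP n. S n t * S m (w\<^sub>0 + t))"
        by (simp add: SUP_mult_left_ennreal SUP_mult_right_ennreal)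
      also have "\<dots> \<le> (SUP n. S n t * S n (w\<^sub>0 + t))"
      proof (intro SUP_least)
        fix n m
        have "S n t * S m (w\<^sub>0 + t) \<le> S (max n m) t * S (max n m) (w\<^sub>0 + t)"
          by (intro mult_mono incseqD[OF S_inc]) auto
        also have "\<dots> \<le> (SUP n. S n t * S n (w\<^sub>0 + t))"
          by (rule SUP_upper) simp
        finally show "S n t * S m (w\<^sub>0 + t) \<le> (SUP n. S n t * S n (w\<^sub>0 + t))" .
      qed
      finally show "(SUP n. S n t) * (SUP n. S n (w\<^sub>0 + t)) \<le> (SUP n. S n t * S n (w\<^sub>0 + t))" .
    qed
    then show "?\<phi> t * ?\<phi> (w\<^sub>0 + t) = (SUP n. S n t * S n (w\<^sub>0 + t))"
      by (simp add: S_sup)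
  qed
  also have "\<dots> = (SUP n. \<integral>\<^sup>+t. S n t * S n (w\<^sub>0 + t) \<partial>\<mu>)"
  proof (rule nn_integral_monotone_convergence_SUP)
    show "incseq (\<lambda>n t. S n t * S n (w\<^sub>0 + t))"
      by (intro incseq_SucI le_funI mult_mono incseq_SucD[OF S_inc]) auto
    show "(\<lambda>t. S n t * S n (w\<^sub>0 + t)) \<in> borel_measurable \<mu>" for n
      unfolding S_prod_V by measurable
  qed
  finally obtain n where n: "l < (\<integral>\<^sup>+t. S n t * S n (w\<^sub>0 + t) \<partial>\<mu>)"
    using less by (auto simp: less_SUP_iff)
  then have n: "l < (\<Sum>p\<in>I n. e p * emeasure \<mu> (V p))"
    unfolding S_prod_V by (simp add: nn_integral_sum nn_integral_cmult_indicator)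
  have "\<exists>C. \<forall>j::nat. compact (C j) \<and> C j \<subseteq> V p \<and> (\<lambda>j. emeasure \<mu> (C j)) \<longlonglongrightarrow> emeasure \<mu> (V p)" for p
    using open_measure_compact_limit[OF haar open_V[of p]] by metis
  then obtain C where C: "\<And>p j::nat. compact (C p j)" "\<And>p j. C p j \<subseteq> V p"
      "\<And>p. (\<lambda>j. emeasure \<mu> (C p j)) \<longlonglongrightarrow> emeasure \<mu> (V p)"
    by metis
  have "(\<lambda>j. \<Sum>p\<in>I n. e p * emeasure \<mu> (C p j)) \<longlonglongrightarrow> (\<Sum>p\<in>I n. e p * emeasure \<mu> (V p))"
    by (intro tendsto_sum ennreal_tendsto_cmult C) (auto simp: e_def ennreal_mult_less_top c)
  then obtain j where j: "l < (\<Sum>p\<in>I n. e p * emeasure \<mu> (C p j))"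
    using order_tendstoD(1)[OF _ n] eventually_happens'[OF sequentially_bot] by blast
  have sets_C [measurable]: "C p j \<in> sets \<mu>" for p
    using compact_imp_closed[OF C(1)] haar by (simp add: sets_haar_measure)
  have "\<exists>N. open N \<and> w\<^sub>0 \<in> N \<and> (\<forall>w\<in>N. \<forall>t\<in>C p j. w + t \<in> U (snd p))" for p
  proof -
    have "w\<^sub>0 + t \<in> U (snd p)" if "t \<in> C p j" for t
      using that C(2)[of p j] by (auto simp: V_def)
    then show ?thesis
      using compact_translate_tube[OF C(1) U] by metis
  qed
  then obtain N where N: "\<And>p. open (N p)" "\<And>p. w\<^sub>0 \<in> N p"
      "\<And>p w t. w \<in> N p \<Longrightarrow> t \<in> C p j \<Longrightarrow> w + t \<in> U (snd p)"
    by metis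
  show ?thesis
  proof (rule that[of "\<Inter>p\<in>I n. N p" "\<lambda>t. \<Sum>p\<in>I n. e p * indicator (C p j) t"])
    show "open (\<Inter>p\<in>I n. N p)"
      by (intro open_INT) (auto simp: I_def N)
    show "w\<^sub>0 \<in> (\<Inter>p\<in>I n. N p)"
      by (auto simp: N)
    show "(\<lambda>t. \<Sum>p\<in>I n. e p * indicator (C p j) t) \<in> borel_measurable \<mu>"
      by measurable
    show "l < (\<integral>\<^sup>+t. (\<Sum>p\<in>I n. e p * indicator (C p j) t) \<partial>\<mu>)"
      using j by (simp add: nn_integral_sum nn_integral_cmult_indicator)
    fix w t assume w: "w \<in> (\<Inter>p\<in>I n. N p)"
    have "(\<Sum>p\<in>I n. e p * indicator (C p j) t) \<le> S n t * S n (w + t)"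
      unfolding S_prod
    proof (intro sum_mono mult_left_mono)
      fix p assume p: "p \<in> I n"
      show "indicator (C p j) t \<le> indicator (U (fst p)) t * (indicator (U (snd p)) (w + t) :: ennreal)"
      proof (cases "t \<in> C p j")
        case True
        then have "t \<in> U (fst p)" "w + t \<in> U (snd p)"
          using C(2)[of p j] N(3) w p by (auto simp: V_def)
        then show ?thesis
          by (simp add: indicator_def)
      qed simp
    qed simp
    also have "\<dots> \<le> ?\<phi> t * ?\<phi> (w + t)"
      by (intro mult_mono S_le) auto
    finally show "(\<Sum>p\<in>I n. e p * indicator (C p j) t) \<le> ?\<phi> t * ?\<phi> (w + t)" .
  qed
qed

lemma finite_cover_disjoint_refinement:
  fixes N :: "'i \<Rightarrow> 'a::topological_space set"
  assumes "finite D" and "\<And>i. i \<in> D \<Longrightarrow> N i \<in> sets borel" and "K \<in> sets borel" and "K \<subseteq> (\<Union>i\<in>D. N i)"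
  obtains E where "\<And>i. i \<in> D \<Longrightarrow> E i \<in> sets borel" and "\<And>i. i \<in> D \<Longrightarrow> E i \<subseteq> N i"
    and "disjoint_family_on E D" and "(\<Union>i\<in>D. E i) = K"
proof -
  have "\<exists>E. (\<forall>i\<in>D. E i \<in> sets borel \<and> E i \<subseteq> N i) \<and> disjoint_family_on E D \<and> (\<Union>i\<in>D. E i) = K"
    using assms
  proof (induction D arbitrary: K rule: finite_induct)
    case empty
    then show ?case
      by (auto simp: disjoint_family_on_def)
  next
    case (insert i D)
    have "K - N i \<in> sets borel" "K - N i \<subseteq> (\<Union>j\<in>D. N j)"
      using insert.prems by auto
    then obtain E where E: "\<forall>j\<in>D. E j \<in> sets borel \<and> E j \<subseteq> N j" "disjoint_family_on E D"
        "(\<Union>j\<in>D. E j) = K - N i"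
      using insert.IH[of "K - N i"] insert.prems by auto
    define E' where "E' = E(i := K \<inter> N i)"
    have E'_i: "E' i = K \<inter> N i" and E'_j: "\<And>j. j \<in> D \<Longrightarrow> E' j = E j"
      using insert.hyps by (auto simp: E'_def)
    have U: "(\<Union>j\<in>D. E' j) = K - N i"
      using E(3) E'_j by simp
    have "\<forall>j\<in>insert i D. E' j \<in> sets borel \<and> E' j \<subseteq> N j"
      using E(1) E'_i E'_j insert.prems by auto
    moreover have "disjoint_family_on E' (insert i D)"
      using E(2) U E'_i E'_j insert.hyps
      by (auto simp: disjoint_family_on_insert disjoint_family_on_def)
    moreover have "(\<Union>j\<in>insert i D. E' j) = K"
      using U E'_i by auto
    ultimately show ?case
      by blast
  qed
  then show ?thesis
    using that by auto
qed

text \<open>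
  A compact \<open>K \<subseteq> {\<Phi> > l}\<close> splits into finitely many disjoint Borel pieces \<open>E\<^sub>v\<close>, each with a function
  \<open>h\<^sub>v\<close> of integral above \<open>l\<close> that lies below \<open>\<phi>(t) \<phi>(w + t)\<close> for every \<open>w \<in> E\<^sub>v\<close>. Hence
  \<open>l \<mu>(K) \<le> \<integral> \<Sum>\<^sub>v \<mu>(E\<^sub>v) h\<^sub>v(t) dt\<close>. For fixed \<open>t\<close> the inner sum is the integral over \<open>w\<close> of
  \<open>\<Sum>\<^sub>v h\<^sub>v(t) 1\<^bsub>E\<^sub>v\<^esub>(w) \<le> \<phi>(t) \<phi>(w + t)\<close>, which translation invariance bounds by \<open>\<phi>(t) \<integral> \<phi>\<close>. Inner
  regularity of the open set \<open>{\<Phi> > l}\<close> passes from \<open>K\<close> to the whole set.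
\<close>

lemma correlation_weak_type:
  fixes \<mu> :: "'a::{topological_ab_group_add, t2_space} measure"
  assumes haar: "haar_measure \<mu>"
    and U: "\<And>k. open (U k)" and c: "\<And>k. c k < top"
  defines "\<phi> \<equiv> open_step_sum c U"
  shows "open {w. l < (\<integral>\<^sup>+t. \<phi> t * \<phi> (w + t) \<partial>\<mu>)}"
    and "l * emeasure \<mu> {w. l < (\<integral>\<^sup>+t. \<phi> t * \<phi> (w + t) \<partial>\<mu>)} \<le> (\<integral>\<^sup>+t. \<phi> t \<partial>\<mu>) * (\<integral>\<^sup>+t. \<phi> t \<partial>\<mu>)"
proof -
  define W where "W = {w. l < (\<integral>\<^sup>+t. \<phi> t * \<phi> (w + t) \<partial>\<mu>)}"
  have \<phi> [measurable]: "\<phi> \<in> borel_measurable \<mu>"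
    using borel_measurable_open_step_sum[OF U, of c] haar
    by (simp add: \<phi>_def measurable_haar_measure_iff)
  define good where "good v M k \<longleftrightarrow> open M \<and> v \<in> M \<and> k \<in> borel_measurable \<mu> \<and> l < (\<integral>\<^sup>+t. k t \<partial>\<mu>)
      \<and> (\<forall>w\<in>M. \<forall>t. k t \<le> \<phi> t * \<phi> (w + t))" for v M k
  have "\<exists>M k. good v M k" if "v \<in> W" for v
  proof -
    have less: "l < (\<integral>\<^sup>+t. open_step_sum c U t * open_step_sum c U (v + t) \<partial>\<mu>)"
      using that by (simp add: W_def \<phi>_def)
    obtain M k where "open M" "v \<in> M" "k \<in> borel_measurable \<mu>" "l < (\<integral>\<^sup>+t. k t \<partial>\<mu>)"
        "\<And>w t. w \<in> M \<Longrightarrow> k t \<le> open_step_sum c U t * open_step_sum c U (w + t)"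
      by (rule correlation_locally_bounded_below[OF haar U c less]) blast
    then have "good v M k"
      by (simp add: good_def \<phi>_def)
    then show ?thesis
      by blast
  qed
  then obtain N h where good: "\<And>v. v \<in> W \<Longrightarrow> good v (N v) (h v)"
    by metis
  have N: "\<And>v. v \<in> W \<Longrightarrow> open (N v)" "\<And>v. v \<in> W \<Longrightarrow> v \<in> N v"
    and h: "\<And>v. v \<in> W \<Longrightarrow> h v \<in> borel_measurable \<mu>" "\<And>v. v \<in> W \<Longrightarrow> l < (\<integral>\<^sup>+t. h v t \<partial>\<mu>)"
    and h_le: "\<And>v w t. v \<in> W \<Longrightarrow> w \<in> N v \<Longrightarrow> h v t \<le> \<phi> t * \<phi> (w + t)"
    using good unfolding good_def by blast+
  have "N v \<subseteq> W" if "v \<in> W" for v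
  proof
    fix w assume "w \<in> N v"
    then have "(\<integral>\<^sup>+t. h v t \<partial>\<mu>) \<le> (\<integral>\<^sup>+t. \<phi> t * \<phi> (w + t) \<partial>\<mu>)"
      using h_le that by (intro nn_integral_mono) blast
    then show "w \<in> W"
      using h(2)[OF that] by (simp add: W_def)
  qed
  then have open_W: "open W"
    using N by (subst open_subopen) blast
  then show "open {w. l < (\<integral>\<^sup>+t. \<phi> t * \<phi> (w + t) \<partial>\<mu>)}"
    by (simp add: W_def)
  from open_W have "emeasure \<mu> W = (SUP K\<in>{K. compact K \<and> K \<subseteq> W}. emeasure \<mu> K)"
    using haar unfolding haar_measure_def by blast
  then have "l * emeasure \<mu> W = (SUP K\<in>{K. compact K \<and> K \<subseteq> W}. l * emeasure \<mu> K)"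
    by (simp add: SUP_mult_left_ennreal)
  also have "\<dots> \<le> (\<integral>\<^sup>+t. \<phi> t \<partial>\<mu>) * (\<integral>\<^sup>+t. \<phi> t \<partial>\<mu>)"
  proof (intro SUP_least)
    fix K assume "K \<in> {K. compact K \<and> K \<subseteq> W}"
    then have K: "compact K" "K \<subseteq> W"
      by auto
    have "K \<subseteq> (\<Union>v\<in>K. N v)"
      using N(2) K(2) by blast
    then obtain D where D: "D \<subseteq> K" "finite D" "K \<subseteq> (\<Union>v\<in>D. N v)"
      using compactE_image[OF K(1), of K N] N(1) K(2) by (metis subsetD)
    have DO: "v \<in> W" if "v \<in> D" for v
      using that D(1) K(2) by blast
    have "K \<in> sets borel"
      using compact_imp_closed[OF K(1)] by simp
    then obtain E where E: "\<And>v. v \<in> D \<Longrightarrow> E v \<in> sets borel" "\<And>v. v \<in> D \<Longrightarrow> E v \<subseteq> N v"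
        "disjoint_family_on E D" "(\<Union>v\<in>D. E v) = K"
      using finite_cover_disjoint_refinement[OF D(2) _ _ D(3)] N(1) DO
      by (metis borel_open)
    have E_sets: "v \<in> D \<Longrightarrow> E v \<in> sets \<mu>" for v
      using E(1) haar by (simp add: sets_haar_measure)
    have "l * emeasure \<mu> K = (\<Sum>v\<in>D. emeasure \<mu> (E v) * l)"
      using sum_emeasure[of E D \<mu>] E E_sets D(2)
      by (simp add: image_subset_iff sum_distrib_left[symmetric] sum_distrib_right[symmetric] mult.commute)
    also have "\<dots> \<le> (\<Sum>v\<in>D. emeasure \<mu> (E v) * (\<integral>\<^sup>+t. h v t \<partial>\<mu>))"
      using h(2) DO by (intro sum_mono mult_left_mono) (auto intro: less_imp_le)
    also have "\<dots> = (\<integral>\<^sup>+t. (\<Sum>v\<in>D. emeasure \<mu> (E v) * h v t) \<partial>\<mu>)"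
      using h(1) DO by (subst nn_integral_sum) (auto simp: nn_integral_cmult)
    also have "\<dots> \<le> (\<integral>\<^sup>+t. \<phi> t * (\<integral>\<^sup>+w. \<phi> w \<partial>\<mu>) \<partial>\<mu>)"
    proof (intro nn_integral_mono)
      fix t
      have shift: "(\<lambda>w. \<phi> (w + t)) \<in> borel_measurable \<mu>"
        by (intro borel_measurable_haar_compose_continuous[OF haar \<phi>] continuous_intros)
      have "(\<Sum>v\<in>D. emeasure \<mu> (E v) * h v t) = (\<integral>\<^sup>+w. (\<Sum>v\<in>D. h v t * indicator (E v) w) \<partial>\<mu>)"
        using E_sets by (subst nn_integral_sum) (auto simp: nn_integral_cmult_indicator mult.commute)
      also have "\<dots> \<le> (\<integral>\<^sup>+w. \<phi> t * \<phi> (w + t) \<partial>\<mu>)"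
      proof (intro nn_integral_mono)
        fix w
        show "(\<Sum>v\<in>D. h v t * indicator (E v) w) \<le> \<phi> t * \<phi> (w + t)"
        proof (cases "\<exists>v\<in>D. w \<in> E v")
          case True
          then obtain v where v: "v \<in> D" "w \<in> E v"
            by blast
          have "w \<notin> E u" if "u \<in> D - {v}" for u
            using that v E(3) unfolding disjoint_family_on_def by blast
          then have "(\<Sum>u\<in>D. h u t * indicator (E u) w) = h v t"
            using v D(2) by (subst sum.remove[of _ v]) (auto intro!: sum.neutral)
          moreover have "h v t \<le> \<phi> t * \<phi> (w + t)"
            using h_le[OF DO[OF v(1)]] v(2) E(2)[OF v(1)] by blast
          ultimately show ?thesis
            by simp
        next
          case False
          then have "(\<Sum>v\<in>D. h v t * indicator (E v) w) = 0"
            by (intro sum.neutral) auto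
          then show ?thesis
            by simp
        qed
      qed
      also have "\<dots> = \<phi> t * (\<integral>\<^sup>+w. \<phi> (t + w) \<partial>\<mu>)"
        using shift by (subst nn_integral_cmult) (auto simp: add.commute)
      also have "\<dots> = \<phi> t * (\<integral>\<^sup>+w. \<phi> w \<partial>\<mu>)"
        by (simp add: nn_integral_haar_translate[OF haar \<phi>])
      finally show "(\<Sum>v\<in>D. emeasure \<mu> (E v) * h v t) \<le> \<phi> t * (\<integral>\<^sup>+w. \<phi> w \<partial>\<mu>)" .
    qed
    also have "\<dots> = (\<integral>\<^sup>+t. \<phi> t \<partial>\<mu>) * (\<integral>\<^sup>+t. \<phi> t \<partial>\<mu>)"
      by (rule nn_integral_multc) (rule \<phi>)
    finally show "l * emeasure \<mu> K \<le> (\<integral>\<^sup>+t. \<phi> t \<partial>\<mu>) * (\<integral>\<^sup>+t. \<phi> t \<partial>\<mu>)" .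
  qed
  finally show "l * emeasure \<mu> {w. l < (\<integral>\<^sup>+t. \<phi> t * \<phi> (w + t) \<partial>\<mu>)} \<le> (\<integral>\<^sup>+t. \<phi> t \<partial>\<mu>) * (\<integral>\<^sup>+t. \<phi> t \<partial>\<mu>)"
    by (simp only: W_def)
qed

text \<open>
  Any majorant \<open>\<phi>\<close> of \<open>|g|\<close> gives \<open>\<integral> |g(t) g(w + t)| dt \<le> \<Phi>(w)\<close>, and the weak type estimate bounds
  \<open>n \<mu>{\<Phi> = \<infinity>}\<close> by the finite number \<open>(\<integral> \<phi>)\<^sup>2\<close> for every \<open>n\<close>.
\<close>

lemma AE_integrable_correlation:
  fixes \<mu> :: "'a::{topological_ab_group_add, t2_space} measure" and g :: "'a \<Rightarrow> complex"
  assumes haar: "haar_measure \<mu>" and g: "integrable \<mu> g"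
  shows "AE w in \<mu>. integrable \<mu> (\<lambda>t. g t * g (w + t))"
proof -
  obtain c U where U: "\<And>k. open (U k)" and c: "\<And>k. c k < top"
    and le: "\<And>t. ennreal (norm (g t)) \<le> open_step_sum c U t"
    and fin: "(\<integral>\<^sup>+t. open_step_sum c U t \<partial>\<mu>) < top"
    using open_step_sum_majorant[OF haar g] by metis
  define \<phi> where "\<phi> = open_step_sum c U"
  define \<Phi> where "\<Phi> w = (\<integral>\<^sup>+t. \<phi> t * \<phi> (w + t) \<partial>\<mu>)" for w
  define Z where "Z = {w. \<Phi> w = top}"
  note weak = correlation_weak_type[OF haar, of U c, OF U c, folded \<phi>_def, folded \<Phi>_def]
  have Z_eq: "Z = (\<Inter>n::nat. {w. of_nat n < \<Phi> w})"
  proof (intro set_eqI iffI)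
    fix w assume w: "w \<in> (\<Inter>n::nat. {w. of_nat n < \<Phi> w})"
    show "w \<in> Z"
    proof (rule ccontr)
      assume "w \<notin> Z"
      then have "\<Phi> w < top"
        by (simp add: Z_def less_top)
      then obtain n :: nat where "\<Phi> w < of_nat n"
        using ennreal_Ex_less_of_nat by blast
      with w show False
        by (auto dest: less_asym)
    qed
  qed (auto simp: Z_def of_nat_less_top)
  have Z_sets: "Z \<in> sets \<mu>"
    unfolding Z_eq using weak(1) haar
    by (intro sets.countable_INT'') (auto simp: sets_haar_measure space_haar_measure)
  have "of_nat n * emeasure \<mu> Z \<le> (\<integral>\<^sup>+t. \<phi> t \<partial>\<mu>) * (\<integral>\<^sup>+t. \<phi> t \<partial>\<mu>)" for n :: nat
  proof -
    have "emeasure \<mu> Z \<le> emeasure \<mu> {w. of_nat n < \<Phi> w}"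
      using weak(1) haar by (intro emeasure_mono) (auto simp: Z_eq sets_haar_measure)
    then have "of_nat n * emeasure \<mu> Z \<le> of_nat n * emeasure \<mu> {w. of_nat n < \<Phi> w}"
      by (intro mult_left_mono) auto
    also have "\<dots> \<le> (\<integral>\<^sup>+t. \<phi> t \<partial>\<mu>) * (\<integral>\<^sup>+t. \<phi> t \<partial>\<mu>)"
      by (rule weak(2))
    finally show ?thesis .
  qed
  then have "(SUP n::nat. of_nat n * emeasure \<mu> Z) \<le> (\<integral>\<^sup>+t. \<phi> t \<partial>\<mu>) * (\<integral>\<^sup>+t. \<phi> t \<partial>\<mu>)"
    by (intro SUP_least)
  also have "\<dots> < top"
    using fin by (simp add: \<phi>_def ennreal_mult_less_top)
  finally have "top * emeasure \<mu> Z < top"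
    by (simp add: SUP_mult_right_ennreal[symmetric] ennreal_SUP_of_nat_eq_top)
  then have "emeasure \<mu> Z = 0"
    by (simp add: ennreal_mult_less_top)
  then have "AE w in \<mu>. w \<notin> Z"
    using Z_sets by (intro AE_not_in) auto
  then show ?thesis
  proof eventually_elim
    case (elim w)
    have "(\<lambda>t. g (w + t)) \<in> borel_measurable \<mu>"
      using measurable_compose[OF measurable_haar_translate[OF haar]] borel_measurable_integrable[OF g] .
    then have "(\<lambda>t. g t * g (w + t)) \<in> borel_measurable \<mu>"
      using g by auto
    moreover have "(\<integral>\<^sup>+t. ennreal (norm (g t * g (w + t))) \<partial>\<mu>) \<le> \<Phi> w"
      unfolding \<Phi>_def \<phi>_def
      by (intro nn_integral_mono) (auto simp: norm_mult ennreal_mult intro!: mult_mono le)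
    ultimately show ?case
      using elim by (intro integrableI_bounded) (auto simp: Z_def less_top top_unique)
  qed
qed

section \<open>Cosine convolution of translates\<close>

text \<open>
  After translation by \<open>- w\<close> the correlation integrand becomes \<open>g(t - w) g(t)\<close>. The set of \<open>t\<close> for which
  evenness fails at \<open>t - w\<close> is a translate of a null set, so this equals \<open>g(t) g(w - t)\<close> almost
  everywhere. Reflecting the variable instead would require the invariance of Haar measure under
  inversion.
\<close>

lemma even_correlation_eq_convolution:
  fixes \<mu> :: "'a::{topological_ab_group_add, t2_space} measure" and g :: "'a \<Rightarrow> complex"
  assumes haar: "haar_measure \<mu>" and g: "g \<in> borel_measurable \<mu>"
    and even: "AE u in \<mu>. g (- u) = g u"
  shows "(\<integral>t. g t * g (w - t) \<partial>\<mu>) = (\<integral>t. g t * g (w + t) \<partial>\<mu>)"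
    and "integrable \<mu> (\<lambda>t. g t * g (w - t)) \<longleftrightarrow> integrable \<mu> (\<lambda>t. g t * g (w + t))"
proof -
  have cont: "continuous_on UNIV (\<lambda>t. w + t)" "continuous_on UNIV (\<lambda>t. - w + t)"
      "continuous_on UNIV (\<lambda>t. w - t)"
    by (intro continuous_intros)+
  note m = cont[THEN borel_measurable_haar_compose_continuous[OF haar g]]
  have m1: "(\<lambda>t. g t * g (w + t)) \<in> borel_measurable \<mu>"
      "(\<lambda>t. g (- w + t) * g (w + (- w + t))) \<in> borel_measurable \<mu>"
    using borel_measurable_times[OF g m(1)] borel_measurable_times[OF m(2) g] by simp_all
  have m2: "(\<lambda>t. g t * g (w - t)) \<in> borel_measurable \<mu>"
    using borel_measurable_times[OF g m(3)] .
  have "AE t in \<mu>. g (- (- w + t)) = g (- w + t)"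
    using AE_haar_translate[OF haar even] .
  then have ae: "AE t in \<mu>. g t * g (w - t) = g (- w + t) * g (w + (- w + t))"
    by eventually_elim (simp add: ac_simps)
  show "(\<integral>t. g t * g (w - t) \<partial>\<mu>) = (\<integral>t. g t * g (w + t) \<partial>\<mu>)"
    using integral_cong_AE[OF m2 m1(2) ae] integral_haar_translate[OF haar m1(1), of "- w"]
    by (rule trans)
  show "integrable \<mu> (\<lambda>t. g t * g (w - t)) \<longleftrightarrow> integrable \<mu> (\<lambda>t. g t * g (w + t))"
    using integrable_cong_AE[OF m2 m1(2) ae] integrable_haar_translate[OF haar m1(1), of "- w"]
    by (rule trans)
qed

theorem theorem2:
  fixes \<mu> :: "'a::{topological_ab_group_add, t2_space} measure"
    and g :: "'a \<Rightarrow> complex" and x y :: 'a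
  assumes "locally_compact_space (euclidean :: 'a topology)"
    and "haar_measure \<mu>"
    and "integrable \<mu> g"
    and "AE u in \<mu>. g (- u) = g u"
  shows "AE u in \<mu>. cosine_conv \<mu> (translate y g) (translate x g) u =
           cosine_conv \<mu> g (\<lambda>v. (translate (x + y) g v + translate (x - y) g v) / 2) u"
proof -
  note haar = assms(2)
  have g: "g \<in> borel_measurable \<mu>"
    using assms(3) by auto
  note even = even_correlation_eq_convolution[OF haar g assms(4)]
  note ae = AE_integrable_correlation[OF haar assms(3)]
  have "AE u in \<mu>. integrable \<mu> (\<lambda>t. g t * g ((y - x) + u + t))"
    and "AE u in \<mu>. integrable \<mu> (\<lambda>t. g t * g ((- y - x) + u + t))"
    using AE_haar_translate[OF haar ae] by blast+
  then show ?thesis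
  proof eventually_elim
    case (elim u)
    define P where "P = (y - x) + u"
    define Q where "Q = (- y - x) + u"
    have P: "integrable \<mu> (\<lambda>t. g t * g (P + t))" "integrable \<mu> (\<lambda>t. g t * g (P - t))"
      and Q: "integrable \<mu> (\<lambda>t. g t * g (Q + t))" "integrable \<mu> (\<lambda>t. g t * g (Q - t))"
      using elim even(2) by (auto simp: P_def Q_def)
    define a where "a = (\<integral>t. g t * g (P + t) \<partial>\<mu>)"
    define b where "b = (\<integral>t. g t * g (Q + t) \<partial>\<mu>)"
    have a': "(\<integral>t. g t * g (P - t) \<partial>\<mu>) = a" and b': "(\<integral>t. g t * g (Q - t) \<partial>\<mu>) = b"
      using even(1) by (simp_all add: a_def b_def)
    let ?f = "\<lambda>t. g (t - y) * ((g (u + t - x) + g (u - t - x)) / 2)"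
    have "?f \<in> borel_measurable \<mu>"
      by (intro borel_measurable_times borel_measurable_divide borel_measurable_add
          borel_measurable_const borel_measurable_haar_compose_continuous[OF haar g] continuous_intros)
    then have "(\<integral>t. ?f t \<partial>\<mu>) = (\<integral>t. ?f (y + t) \<partial>\<mu>)"
      by (rule integral_haar_translate[OF haar, symmetric])
    also have "\<dots> = (\<integral>t. (g t * g (P + t) + g t * g (Q - t)) / 2 \<partial>\<mu>)"
    proof (intro Bochner_Integration.integral_cong refl)
      fix t
      have "y + t - y = t" "u + (y + t) - x = P + t" "u - (y + t) - x = Q - t"
        by (simp_all add: P_def Q_def algebra_simps)
      then show "?f (y + t) = (g t * g (P + t) + g t * g (Q - t)) / 2"
        by (simp only: times_divide_eq_right distrib_left)
    qed
    also have "\<dots> = (a + b) / 2"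
      using P Q by (simp add: a_def b')
    also have "\<dots> = (\<integral>t. ((g t * g (Q + t) + g t * g (P + t)) + (g t * g (Q - t) + g t * g (P - t))) / 4 \<partial>\<mu>)"
      using P Q by (simp add: a' b' flip: a_def b_def)
    also have "\<dots> = (\<integral>t. g t * (((g (u + t - (x + y)) + g (u + t - (x - y))) / 2
        + (g (u - t - (x + y)) + g (u - t - (x - y))) / 2) / 2) \<partial>\<mu>)"
    proof (intro Bochner_Integration.integral_cong refl)
      fix t
      have args: "u + t - (x + y) = Q + t" "u + t - (x - y) = P + t"
          "u - t - (x + y) = Q - t" "u - t - (x - y) = P - t"
        by (simp_all add: P_def Q_def algebra_simps)
      have mean: "((r * p + r * q) + (r * p' + r * q')) / 4
          = r * (((p + q) / 2 + (p' + q') / 2) / 2)" for r p q p' q' :: complex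
        by (simp add: distrib_left add_divide_distrib)
      show "((g t * g (Q + t) + g t * g (P + t)) + (g t * g (Q - t) + g t * g (P - t))) / 4
          = g t * (((g (u + t - (x + y)) + g (u + t - (x - y))) / 2
            + (g (u - t - (x + y)) + g (u - t - (x - y))) / 2) / 2)"
        unfolding args by (rule mean)
    qed
    finally show ?case
      unfolding cosine_conv_def translate_def .
  qed
qed

end
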